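(* Let $n,k,\ell$ be positive integers with $\ell\ge k>0$ and $n\ge k+\ell$. Let $\mathcal{A}\subseteq\binom{[n]}{k}$ and $\mathcal{B}\subseteq\binom{[n]}{\ell}$ be cross-intersecting families such that \[|\mathcal{B}|\ge\sum_{i=1}^{r}\binom{n-i}{\ell-1}+\binom{n-r-s}{\ell-s}\] for some integers $r\ge1$ and $2\le s\le\ell$. Then \[|\mathcal{A}||\mathcal{B}|\le\left(\binom{n-r}{k-r}-\binom{n-r-s}{k-r}\right)\left(\sum_{i=1}^{r}\binom{n-i}{\ell-1}+\binom{n-r-s}{\ell-s}\right).\]
   Context: $[n]=\{1,\dots,n\}$; $\binom{[n]}{k}$ is the family of $k$-subsets of $[n]$. Families $\mathcal{A},\mathcal{B}$ are cross-intersecting if $A\cap B\neq\emptyset$ for all $A\in\mathcal{A}$, $B\in\mathcal{B}$. *)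

theory Defs
  imports Complex_Main "HOL-Library.Ramsey"
begin

definition cross_intersecting :: "'a set set \<Rightarrow> 'a set set \<Rightarrow> bool" where
  "cross_intersecting \<A> \<B> \<longleftrightarrow> (\<forall>A\<in>\<A>. \<forall>B\<in>\<B>. A \<inter> B \<noteq> {})"

text \<open>
  Binomial coefficient with the counting convention: it vanishes unless
  \<open>0 \<le> b \<le> a\<close>. The arguments are integers because differences such as \<open>k - r\<close> and
  \<open>n - r - s\<close> may be negative; truncated subtraction on the natural numbers would
  wrongly turn a coefficient with a negative argument into one with argument 0.
\<close>

definition binom :: "int \<Rightarrow> int \<Rightarrow> int" where
  "binom a b = (if 0 \<le> a \<and> 0 \<le> b then int (nat a choose nat b) else 0)"

end

theory Submission
  imports Defs
begin

text \<open>
  Compressions replacing \<open>V\<close> by \<open>U \<ni> x\<close>, applied for minimal bad \<open>V\<close> first, keep two families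
  cross-intersecting; once none of them is effective, each family either lies in the star of \<open>x\<close>
  or contains it. Removing \<open>x\<close> then turns sizes \<open>(a, b)\<close> realised for \<open>(n, k, l)\<close> into sizes
  realised on \<open>n - 1\<close> points, and the disjointness graph (local LYM) bounds what is left.

  The extremal pair for \<open>(r, s)\<close> consists of the \<open>l\<close>-sets meeting \<open>[r]\<close> or containing
  \<open>{r+1, \<dots>, r+s}\<close>, and the \<open>k\<close>-sets containing \<open>[r]\<close> and meeting \<open>{r+1, \<dots>, r+s}\<close>. Enlarging
  the second size moves through the pairs \<open>(r, s), (r, s - 1), \<dots>, (r, 1), (r + 1, l), \<dots>\<close>, and the
  product decreases along the way. Between \<open>(r, s)\<close> and \<open>(r, s - 1)\<close> the LYM bound is linear, so
  only the slope at the start matters, except for \<open>(r, s) = (1, 2)\<close>, where the residual pair obeys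
  the case \<open>(0, 1)\<close> for \<open>(n - 2, k - 1, l - 1)\<close>. From \<open>(r, 1)\<close> one jumps directly to \<open>(r + 1, l)\<close>,
  whose second family is larger by one set only.
\<close>

section \<open>Compressions towards a point\<close>

definition compression :: "'a set \<Rightarrow> 'a set \<Rightarrow> 'a set set \<Rightarrow> 'a set \<Rightarrow> 'a set" where
  "compression U V \<F> G =
     (if V \<subseteq> G \<and> U \<inter> G = {} \<and> G - V \<union> U \<notin> \<F> then G - V \<union> U else G)"

definition compressed :: "'a set \<Rightarrow> 'a set \<Rightarrow> 'a set set \<Rightarrow> bool" where
  "compressed U V \<F> \<longleftrightarrow> (\<forall>G\<in>\<F>. V \<subseteq> G \<longrightarrow> U \<inter> G = {} \<longrightarrow> G - V \<union> U \<in> \<F>)"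

lemma cross_intersecting_commute: "cross_intersecting \<A> \<B> \<longleftrightarrow> cross_intersecting \<B> \<A>"
  unfolding cross_intersecting_def by (metis Int_commute)

lemma inj_on_compression: "inj_on (compression U V \<F>) \<F>"
proof (rule inj_onI)
  fix G H assume GH: "G \<in> \<F>" "H \<in> \<F>" "compression U V \<F> G = compression U V \<F> H"
  then show "G = H"
    unfolding compression_def by (auto split: if_splits)
qed

lemma card_compression: "card (compression U V \<F> ` \<F>) = card \<F>"
  by (rule card_image[OF inj_on_compression])

lemma compression_in_nsets:
  assumes "\<F> \<subseteq> nsets M k" "U \<subseteq> M" "finite U" "card U = card V"
  shows "compression U V \<F> ` \<F> \<subseteq> nsets M k"
proof
  fix H assume "H \<in> compression U V \<F> ` \<F>"
  then obtain G where G: "G \<in> \<F>" "H = compression U V \<F> G" by blast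
  then have Gn: "G \<subseteq> M" "finite G" "card G = k"
    using assms(1) by (auto simp: nsets_def)
  show "H \<in> nsets M k"
  proof (cases "V \<subseteq> G \<and> U \<inter> G = {} \<and> G - V \<union> U \<notin> \<F>")
    case True
    then have H: "H = G - V \<union> U" using G by (auto simp: compression_def)
    have "card H = card (G - V) + card U"
      unfolding H using True Gn assms(3) by (intro card_Un_disjoint) auto
    also have "\<dots> = k"
      using True Gn assms(4) by (metis card_Diff_subset card_mono finite_subset le_add_diff_inverse2)
    finally show ?thesis
      using H Gn assms(2,3) by (auto simp: nsets_def)
  next
    case False
    then show ?thesis using G Gn by (auto simp: compression_def nsets_def)
  qed
qed

text \<open>If the moved set missed \<open>H\<close>, then \<open>G\<close> would meet
  \<open>H\<close> only inside \<open>W = V \<inter> H\<close>. When \<open>V \<subseteq> H\<close>,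
  the set \<open>G\<close> misses \<open>H - V \<union> U \<in> \<B>\<close>. Otherwise
  \<open>W\<close> is a proper part of \<open>V\<close>, and exchanging it for an equally large
  \<open>U' \<subseteq> U\<close> through \<open>x\<close> stays in \<open>\<A>\<close> but yields a
  set missing \<open>H\<close>.\<close>

lemma moved_set_meets_unmoved:
  assumes cross: "cross_intersecting \<A> \<B>"
    and UV: "U \<inter> V = {}" "card U = card V" "finite U" "finite V" "x \<in> U"
    and small: "\<And>U' V'. \<lbrakk>x \<in> U'; U' \<subseteq> U; V' \<subset> V; card U' = card V'\<rbrakk> \<Longrightarrow> compressed U' V' \<A>"
    and G: "G \<in> \<A>" "V \<subseteq> G" "U \<inter> G = {}"
    and H: "H \<in> \<B>" "V \<subseteq> H \<longrightarrow> U \<inter> H = {} \<longrightarrow> H - V \<union> U \<in> \<B>"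
  shows "(G - V \<union> U) \<inter> H \<noteq> {}"
proof
  assume dis: "(G - V \<union> U) \<inter> H = {}"
  let ?W = "V \<inter> H"
  have GH: "G \<inter> H \<noteq> {}" using cross G H by (auto simp: cross_intersecting_def)
  have W: "?W \<noteq> {}" using GH dis by blast
  show False
  proof (cases "V \<subseteq> H")
    case True
    then have "H - V \<union> U \<in> \<B>" using H dis by blast
    then have "G \<inter> (H - V \<union> U) \<noteq> {}" using cross G by (auto simp: cross_intersecting_def)
    then show False using dis G by blast
  next
    case False
    have "finite ?W" using UV by simp
    then have "0 < card ?W" using W by (simp add: card_gt_0_iff)
    moreover have "card ?W \<le> card U"
      using UV by (metis Int_lower1 card_mono)
    ultimately have "\<exists>U'. {x} \<subseteq> U' \<and> U' \<subseteq> U \<and> card U' = card ?W"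
      using UV by (intro exists_subset_between) auto
    then obtain U' where U': "x \<in> U'" "U' \<subseteq> U" "card U' = card ?W" by auto
    have "compressed U' ?W \<A>" using small[of U' ?W] U' False by auto
    then have "G - ?W \<union> U' \<in> \<A>" using G U' unfolding compressed_def by blast
    then have "(G - ?W \<union> U') \<inter> H \<noteq> {}" using cross H by (auto simp: cross_intersecting_def)
    then show False using dis U' by blast
  qed
qed

lemma cross_intersecting_compression:
  assumes cross: "cross_intersecting \<A> \<B>"
    and UV: "U \<inter> V = {}" "card U = card V" "finite U" "finite V" "x \<in> U"
    and small: "\<And>U' V'. \<lbrakk>x \<in> U'; U' \<subseteq> U; V' \<subset> V; card U' = card V'\<rbrakk>
                  \<Longrightarrow> compressed U' V' \<A> \<and> compressed U' V' \<B>"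
  shows "cross_intersecting (compression U V \<A> ` \<A>) (compression U V \<B> ` \<B>)"
  unfolding cross_intersecting_def
proof safe
  fix G H assume G: "G \<in> \<A>" and H: "H \<in> \<B>"
    and empty: "compression U V \<A> G \<inter> compression U V \<B> H = {}"
  let ?mA = "V \<subseteq> G \<and> U \<inter> G = {} \<and> G - V \<union> U \<notin> \<A>"
  let ?mB = "V \<subseteq> H \<and> U \<inter> H = {} \<and> H - V \<union> U \<notin> \<B>"
  have cross': "cross_intersecting \<B> \<A>" using cross cross_intersecting_commute by blast
  consider "?mA" "?mB" | "?mA" "\<not> ?mB" | "\<not> ?mA" "?mB" | "\<not> ?mA" "\<not> ?mB" by blast
  then show False
  proof cases
    case 1
    then have "x \<in> compression U V \<A> G \<inter> compression U V \<B> H"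
      using UV by (auto simp: compression_def)
    then show False using empty by blast
  next
    case 2
    then have "(G - V \<union> U) \<inter> H \<noteq> {}"
      using moved_set_meets_unmoved[OF cross UV, of G H] small G H by blast
    then show False using 2 empty unfolding compression_def by (auto split: if_splits)
  next
    case 3
    then have "(H - V \<union> U) \<inter> G \<noteq> {}"
      using moved_set_meets_unmoved[OF cross' UV, of H G] small G H by blast
    then show False using 3 empty unfolding compression_def by (auto split: if_splits)
  next
    case 4
    then have "G \<inter> H = {}"
      using empty unfolding compression_def by (auto split: if_splits)
    then show False using cross G H by (auto simp: cross_intersecting_def)
  qed
qed

text \<open>Sets through \<open>x\<close> never move and moved sets gain \<open>x\<close>, so this
  count is a potential that grows with every effective compression.\<close>

lemma compression_star:
  assumes "x \<in> U" "finite \<F>"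
  shows "card {G \<in> \<F>. x \<in> G} \<le> card {G \<in> compression U V \<F> ` \<F>. x \<in> G}"
    and "\<not> compressed U V \<F> \<Longrightarrow>
      card {G \<in> \<F>. x \<in> G} < card {G \<in> compression U V \<F> ` \<F>. x \<in> G}"
proof -
  have fixed: "compression U V \<F> G = G" if "x \<in> G" for G
    using that assms by (auto simp: compression_def)
  have sub: "{G \<in> \<F>. x \<in> G} \<subseteq> {G \<in> compression U V \<F> ` \<F>. x \<in> G}"
  proof
    fix G assume "G \<in> {G \<in> \<F>. x \<in> G}"
    then have "G \<in> \<F>" "x \<in> G" by auto
    then show "G \<in> {G \<in> compression U V \<F> ` \<F>. x \<in> G}"
      using imageI[of G \<F> "compression U V \<F>"] fixed[of G] by simp
  qed
  show "card {G \<in> \<F>. x \<in> G} \<le> card {G \<in> compression U V \<F> ` \<F>. x \<in> G}"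
    using sub assms by (intro card_mono) auto
  assume "\<not> compressed U V \<F>"
  then obtain G where G: "G \<in> \<F>" "V \<subseteq> G" "U \<inter> G = {}" "G - V \<union> U \<notin> \<F>"
    by (auto simp: compressed_def)
  then have "compression U V \<F> G = G - V \<union> U" by (simp add: compression_def)
  then have "G - V \<union> U \<in> {G \<in> compression U V \<F> ` \<F>. x \<in> G}"
    using G assms by (metis (mono_tags, lifting) UnI2 imageI mem_Collect_eq)
  then have "{G \<in> \<F>. x \<in> G} \<subset> {G \<in> compression U V \<F> ` \<F>. x \<in> G}"
    using sub G by blast
  then show "card {G \<in> \<F>. x \<in> G} < card {G \<in> compression U V \<F> ` \<F>. x \<in> G}"
    using assms by (intro psubset_card_mono) auto
qed

text \<open>A member \<open>F\<close> avoiding \<open>x\<close> and a missing set \<open>G\<close>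
  through \<open>x\<close> would violate stability under exchanging \<open>F - G\<close> for
  \<open>G - F\<close>, which turns \<open>F\<close> into \<open>G\<close>.\<close>

lemma star_of_compressed:
  assumes "\<F> \<subseteq> nsets M k"
    and "\<And>U V. \<lbrakk>x \<in> U; U \<subseteq> M; finite U; U \<inter> V = {}; card U = card V\<rbrakk> \<Longrightarrow> compressed U V \<F>"
  shows "(\<forall>F\<in>\<F>. x \<in> F) \<or> {F \<in> nsets M k. x \<in> F} \<subseteq> \<F>"
proof (rule disjCI, rule ballI, rule ccontr)
  fix F assume notsub: "\<not> {F \<in> nsets M k. x \<in> F} \<subseteq> \<F>" and F: "F \<in> \<F>" "x \<notin> F"
  obtain G where G: "G \<in> nsets M k" "x \<in> G" "G \<notin> \<F>" using notsub by blast
  have fin: "finite F" "finite G" "card F = card G"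
    using assms(1) F G by (auto simp: nsets_def)
  have "card (G - F) = card (F - G)"
    using fin by (metis Int_commute card_Diff_subset_Int finite_Int)
  then have "compressed (G - F) (F - G) \<F>"
    using assms(2)[of "G - F" "F - G"] G F fin by (auto simp: nsets_def)
  then have "F - (F - G) \<union> (G - F) \<in> \<F>"
    using F unfolding compressed_def by blast
  moreover have "F - (F - G) \<union> (G - F) = G" by blast
  ultimately show False using G by simp
qed

lemma star_dichotomy:
  assumes "finite M" "\<A> \<subseteq> nsets M k" "\<B> \<subseteq> nsets M l" "cross_intersecting \<A> \<B>"
  obtains \<A>' \<B>' where
    "\<A>' \<subseteq> nsets M k" "\<B>' \<subseteq> nsets M l" "cross_intersecting \<A>' \<B>'"
    "card \<A>' = card \<A>" "card \<B>' = card \<B>"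
    "(\<forall>F\<in>\<A>'. x \<in> F) \<or> {F \<in> nsets M k. x \<in> F} \<subseteq> \<A>'"
    "(\<forall>F\<in>\<B>'. x \<in> F) \<or> {F \<in> nsets M l. x \<in> F} \<subseteq> \<B>'"
proof -
  let ?w = "\<lambda>\<F>. card {G \<in> \<F>. x \<in> G}"
  have "\<exists>\<A>' \<B>'. \<A>' \<subseteq> nsets M k \<and> \<B>' \<subseteq> nsets M l \<and> cross_intersecting \<A>' \<B>' \<and>
      card \<A>' = card \<A> \<and> card \<B>' = card \<B> \<and>
      ((\<forall>F\<in>\<A>'. x \<in> F) \<or> {F \<in> nsets M k. x \<in> F} \<subseteq> \<A>') \<and>
      ((\<forall>F\<in>\<B>'. x \<in> F) \<or> {F \<in> nsets M l. x \<in> F} \<subseteq> \<B>')"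
    using assms(2-)
  \<comment> \<open>The measure counts the members of both families that avoid
    \<open>x\<close>.\<close>
  proof (induction "card \<A> + card \<B> - (?w \<A> + ?w \<B>)" arbitrary: \<A> \<B> rule: less_induct)
    case less
    have fin: "finite \<A>" "finite \<B>"
      using less.prems \<open>finite M\<close> finite_imp_finite_nsets finite_subset by blast+
    define bad where "bad U V \<longleftrightarrow> x \<in> U \<and> U \<subseteq> M \<and> U \<inter> V = {} \<and> card U = card V \<and>
      \<not> (compressed U V \<A> \<and> compressed U V \<B>)" for U V
    show ?case
    proof (cases "\<exists>U V. bad U V")
      case False
      have "compressed U V \<A>" "compressed U V \<B>"
        if "x \<in> U" "U \<subseteq> M" "finite U" "U \<inter> V = {}" "card U = card V" for U V
        using False that unfolding bad_def by auto
      then have "(\<forall>F\<in>\<A>. x \<in> F) \<or> {F \<in> nsets M k. x \<in> F} \<subseteq> \<A>"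
        "(\<forall>F\<in>\<B>. x \<in> F) \<or> {F \<in> nsets M l. x \<in> F} \<subseteq> \<B>"
        using star_of_compressed[OF less.prems(1)] star_of_compressed[OF less.prems(2)]
        by simp_all
      then show ?thesis
        using less.prems by (intro exI[of _ \<A>] exI[of _ \<B>] conjI) simp_all
    next
      case True
      \<comment> \<open>Taking \<open>V\<close> of least size makes all exchanges of proper subsets
        of \<open>V\<close> ineffective, which is what preserves cross-intersection.\<close>
      define d where "d = (LEAST d. \<exists>U V. bad U V \<and> card V = d)"
      have "\<exists>U V. bad U V \<and> card V = d"
        unfolding d_def by (rule LeastI_ex) (use True in blast)
      then obtain U V where "bad U V" "card V = d" by blast
      then have UV: "x \<in> U" "U \<subseteq> M" "U \<inter> V = {}" "card U = card V"
        and not_compressed: "\<not> (compressed U V \<A> \<and> compressed U V \<B>)"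
        unfolding bad_def by simp_all
      have "finite U" using UV \<open>finite M\<close> finite_subset by blast
      \<comment> \<open>An infinite \<open>V\<close> would have cardinality 0, whereas the finite
        set \<open>U\<close> contains \<open>x\<close>.\<close>
      then have "finite V" using UV by (metis card_gt_0_iff empty_iff)
      have small: "compressed U' V' \<A> \<and> compressed U' V' \<B>"
        if "x \<in> U'" "U' \<subseteq> U" "V' \<subset> V" "card U' = card V'" for U' V'
      proof (rule ccontr)
        assume nc: "\<not> ?thesis"
        have "U' \<subseteq> M" "U' \<inter> V' = {}" using that UV by blast+
        then have "bad U' V'" unfolding bad_def using that nc by simp
        then have "d \<le> card V'" unfolding d_def by (intro Least_le) blast
        then show False
          using psubset_card_mono[OF \<open>finite V\<close> that(3)] \<open>card V = d\<close> by simp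
      qed
      let ?A = "compression U V \<A> ` \<A>" and ?B = "compression U V \<B> ` \<B>"
      have cr: "cross_intersecting ?A ?B"
        using cross_intersecting_compression[OF less.prems(3) UV(3,4) \<open>finite U\<close> \<open>finite V\<close> UV(1)] small
        by blast
      have sub: "?A \<subseteq> nsets M k" "?B \<subseteq> nsets M l"
        using compression_in_nsets less.prems UV \<open>finite U\<close> by blast+
      have "?w \<A> + ?w \<B> < ?w ?A + ?w ?B"
        using compression_star[OF UV(1) fin(1), of V] compression_star[OF UV(1) fin(2), of V] not_compressed
        by linarith
      moreover have "?w ?A \<le> card ?A" "?w ?B \<le> card ?B"
        using fin by (auto intro!: card_mono)
      ultimately have "card ?A + card ?B - (?w ?A + ?w ?B) < card \<A> + card \<B> - (?w \<A> + ?w \<B>)"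
        unfolding card_compression by linarith
      from less.hyps[OF this sub cr] show ?thesis
        unfolding card_compression by blast
    qed
  qed
  then show ?thesis using that by blast
qed

section \<open>Sizes of cross-intersecting pairs\<close>

text \<open>Only sizes are recorded, because compressions replace the families and removing a point
  replaces the ground set.\<close>

definition cross_pair :: "nat \<Rightarrow> nat \<Rightarrow> nat \<Rightarrow> nat \<Rightarrow> nat \<Rightarrow> bool" where
  "cross_pair n k l a b \<longleftrightarrow>
     (\<exists>(M :: nat set) \<A> \<B>. finite M \<and> card M = n \<and> \<A> \<subseteq> nsets M k \<and> \<B> \<subseteq> nsets M l \<and>
        cross_intersecting \<A> \<B> \<and> card \<A> = a \<and> card \<B> = b)"

lemma cross_pair_mono:
  assumes "cross_pair n k l a b" "a' \<le> a" "b' \<le> b"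
  shows "cross_pair n k l a' b'"
proof -
  obtain M :: "nat set" and \<A> \<B> where M: "finite M" "card M = n" "\<A> \<subseteq> nsets M k" "\<B> \<subseteq> nsets M l"
    "cross_intersecting \<A> \<B>" "card \<A> = a" "card \<B> = b"
    using assms(1) unfolding cross_pair_def by blast
  obtain \<A>' where A: "\<A>' \<subseteq> \<A>" "card \<A>' = a'"
    using obtain_subset_with_card_n[of a' \<A>] assms M by metis
  obtain \<B>' where B: "\<B>' \<subseteq> \<B>" "card \<B>' = b'"
    using obtain_subset_with_card_n[of b' \<B>] assms M by metis
  have "cross_intersecting \<A>' \<B>'"
    using A B M(5) unfolding cross_intersecting_def by blast
  then show ?thesis
    using M A B unfolding cross_pair_def
    by (intro exI[of _ M] exI[of _ \<A>'] exI[of _ \<B>']) auto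
qed

lemma cross_pair_le_choose:
  assumes "cross_pair n k l a b"
  shows "a \<le> n choose k" "b \<le> n choose l"
proof -
  obtain M :: "nat set" and \<A> \<B> where M: "finite M" "card M = n" "\<A> \<subseteq> nsets M k" "\<B> \<subseteq> nsets M l"
    "card \<A> = a" "card \<B> = b"
    using assms(1) unfolding cross_pair_def by blast
  show "a \<le> n choose k" "b \<le> n choose l"
    using M card_mono[OF finite_imp_finite_nsets[OF M(1)] M(3)]
      card_mono[OF finite_imp_finite_nsets[OF M(1)] M(4)] by auto
qed

text \<open>Counting the disjoint pairs: those with first component in \<open>\<A>\<close> and those with second
  component in \<open>\<B>\<close> are distinct, and the disjointness graph is biregular.\<close>
lemma cross_pair_LYM:
  assumes "cross_pair n k l a b" "k + l \<le> n"
  shows "a * (n choose l) + b * (n choose k) \<le> (n choose k) * (n choose l)"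
proof -
  obtain M :: "nat set" and \<A> \<B> where M: "finite M" "card M = n" "\<A> \<subseteq> nsets M k" "\<B> \<subseteq> nsets M l"
    "cross_intersecting \<A> \<B>" "card \<A> = a" "card \<B> = b"
    using assms(1) unfolding cross_pair_def by blast
  have fin: "finite (nsets M j)" for j using M finite_imp_finite_nsets by blast
  let ?T = "SIGMA P : nsets M k. nsets (M - P) l"
  let ?TA = "SIGMA P : \<A>. nsets (M - P) l"
  let ?TB = "SIGMA Q : \<B>. nsets (M - Q) k"
  have deg: "card (nsets (M - P) q) = (n - p choose q)" if "P \<in> nsets M p" for P p q
  proof -
    have "P \<subseteq> M" "finite P" "card P = p" using that by (auto simp: nsets_def)
    then show ?thesis using M(2) by (simp add: card_Diff_subset)
  qed
  have finD: "finite (nsets (M - P) q)" for P q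
    using M finite_imp_finite_nsets by blast
  have sigma: "card (SIGMA P : \<F>. nsets (M - P) q) = card \<F> * (n - p choose q)"
    if "\<F> \<subseteq> nsets M p" for \<F> p q
  proof -
    have "card (SIGMA P : \<F>. nsets (M - P) q) = (\<Sum>P\<in>\<F>. card (nsets (M - P) q))"
      using that fin finD finite_subset by (intro card_SigmaI) blast+
    also have "\<dots> = (\<Sum>P\<in>\<F>. n - p choose q)" using that deg by (intro sum.cong) blast+
    finally show ?thesis by simp
  qed
  have T: "card ?T = (n choose k) * (n - k choose l)" using sigma[of "nsets M k" k l] M(2) by simp
  have TA: "card ?TA = a * (n - k choose l)" using sigma M by simp
  have TB: "card (prod.swap ` ?TB) = b * (n - l choose k)"
    using sigma[OF M(4), of k] M(7) by (simp add: card_image)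
  have finT: "finite ?T" using fin finD by blast
  have sub: "?TA \<union> prod.swap ` ?TB \<subseteq> ?T"
    using M(3,4) unfolding nsets_def by (auto; blast)
  have "?TA \<inter> prod.swap ` ?TB = {}"
    using M(5) unfolding cross_intersecting_def nsets_def by (auto; blast)
  then have "card ?TA + card (prod.swap ` ?TB) = card (?TA \<union> prod.swap ` ?TB)"
    using sub finT by (metis card_Un_disjoint finite_Un finite_subset)
  also have "\<dots> \<le> card ?T" using sub finT by (rule card_mono[rotated])
  finally have main: "a * (n - k choose l) + b * (n - l choose k) \<le> (n choose k) * (n - k choose l)"
    unfolding T TA TB .
  \<comment> \<open>Both sides count the disjoint pairs of a \<open>k\<close>-set and an
    \<open>l\<close>-set, grouped by one component or the other.\<close>
  have bireg: "(n choose k) * (n - k choose l) = (n choose l) * (n - l choose k)"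
    using choose_mult[of k "k + l" n] choose_mult[of l "k + l" n] assms(2)
      binomial_symmetric[of k "k + l"] by simp
  have pos: "0 < (n choose l) * (n - l choose k)" using assms(2) by simp
  have "(a * (n choose l) + b * (n choose k)) * ((n choose l) * (n - l choose k)) =
      (n choose k) * (n choose l) * (a * (n - k choose l) + b * (n - l choose k))"
    using bireg by algebra
  also have "\<dots> \<le> (n choose k) * (n choose l) * ((n choose k) * (n - k choose l))"
    using main by (rule mult_le_mono2)
  finally show ?thesis using pos unfolding bireg by simp
qed

section \<open>Splitting off a point\<close>

lemma nsets_star:
  assumes "finite M" "x \<in> M" "0 < k"
  shows "{F \<in> nsets M k. x \<in> F} = insert x ` nsets (M - {x}) (k - 1)"
proof
  show "{F \<in> nsets M k. x \<in> F} \<subseteq> insert x ` nsets (M - {x}) (k - 1)"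
  proof
    fix F assume "F \<in> {F \<in> nsets M k. x \<in> F}"
    then have "F = insert x (F - {x})" "F - {x} \<in> nsets (M - {x}) (k - 1)"
      by (auto simp: nsets_def)
    then show "F \<in> insert x ` nsets (M - {x}) (k - 1)" by blast
  qed
  show "insert x ` nsets (M - {x}) (k - 1) \<subseteq> {F \<in> nsets M k. x \<in> F}"
    using assms by (auto simp: nsets_def card_insert_if)
qed

lemma card_nsets_star:
  assumes "finite M" "x \<in> M" "0 < k"
  shows "card {F \<in> nsets M k. x \<in> F} = (card M - 1 choose (k - 1))"
proof -
  have "inj_on (insert x) (nsets (M - {x}) (k - 1))"
    by (rule inj_onI) (auto simp: nsets_def dest: insert_ident[THEN iffD1, rotated 2])
  then show ?thesis
    using assms by (simp add: nsets_star card_image)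
qed

lemma card_remove_point:
  assumes "\<forall>F\<in>\<F>. x \<in> F"
  shows "card ((\<lambda>F. F - {x}) ` \<F>) = card \<F>"
  using assms by (intro card_image inj_onI) (metis insert_Diff)

lemma cross_pair_star:
  assumes "cross_pair n k l a b" "0 < n"
  obtains M :: "nat set" and \<A> \<B> x where
    "finite M" "card M = n" "x \<in> M" "\<A> \<subseteq> nsets M k" "\<B> \<subseteq> nsets M l"
    "cross_intersecting \<A> \<B>" "card \<A> = a" "card \<B> = b"
    "(\<forall>F\<in>\<B>. x \<in> F) \<or> {F \<in> nsets M l. x \<in> F} \<subseteq> \<B>"
proof -
  obtain M :: "nat set" and \<A> \<B> where M: "finite M" "card M = n" "\<A> \<subseteq> nsets M k" "\<B> \<subseteq> nsets M l"
    "cross_intersecting \<A> \<B>" "card \<A> = a" "card \<B> = b"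
    using assms(1) unfolding cross_pair_def by blast
  obtain x where "x \<in> M" using M assms(2) by fastforce
  obtain \<A>' \<B>' where
    "\<A>' \<subseteq> nsets M k" "\<B>' \<subseteq> nsets M l" "cross_intersecting \<A>' \<B>'"
    "card \<A>' = card \<A>" "card \<B>' = card \<B>"
    "(\<forall>F\<in>\<B>'. x \<in> F) \<or> {F \<in> nsets M l. x \<in> F} \<subseteq> \<B>'"
    by (rule star_dichotomy[OF M(1,3-5), where x = x]) (rule that; assumption)
  then show ?thesis using that[of M x \<A>' \<B>'] M \<open>x \<in> M\<close> by simp
qed

text \<open>A compressed \<open>\<B>\<close> at least as large as the star of \<open>x\<close>
  contains that star. Then every member of \<open>\<A>\<close> contains \<open>x\<close>: since
  \<open>k + l \<le> n\<close>, a member avoiding \<open>x\<close> would leave room for a disjoint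
  \<open>l\<close>-set through \<open>x\<close>. Deleting the star from \<open>\<B>\<close> and
  \<open>x\<close> from the members of \<open>\<A>\<close> keeps the pair
  cross-intersecting.\<close>

lemma cross_pair_peel_large:
  assumes "cross_pair n k l a b" "k + l \<le> n" "0 < l" "0 < a" "(n - 1 choose (l - 1)) \<le> b"
  shows "0 < k" "cross_pair (n - 1) (k - 1) l a (b - (n - 1 choose (l - 1)))"
proof -
  have n: "0 < n" using assms(2,3) by simp
  obtain M :: "nat set" and \<A> \<B> x where M: "finite M" "card M = n" "x \<in> M" "\<A> \<subseteq> nsets M k"
    "\<B> \<subseteq> nsets M l" "cross_intersecting \<A> \<B>" "card \<A> = a" "card \<B> = b"
    and dich: "(\<forall>F\<in>\<B>. x \<in> F) \<or> {F \<in> nsets M l. x \<in> F} \<subseteq> \<B>"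
    by (rule cross_pair_star[OF assms(1) n]) (rule that; assumption)
  let ?S = "{F \<in> nsets M l. x \<in> F}"
  have fin: "finite (nsets M l)" "finite \<B>"
    using M finite_imp_finite_nsets finite_subset by blast+
  have cS: "card ?S = (n - 1 choose (l - 1))"
    using card_nsets_star[OF M(1,3) assms(3)] M(2) by simp
  have S: "?S \<subseteq> \<B>"
  proof (cases "\<forall>F\<in>\<B>. x \<in> F")
    case True
    then have "\<B> \<subseteq> ?S" using M(5) by blast
    then have "\<B> = ?S"
      using card_seteq[of ?S \<B>] fin cS assms(5) M(8) by simp
    then show ?thesis by simp
  qed (use dich in blast)
  have xA: "x \<in> F" if F: "F \<in> \<A>" for F
  proof (rule ccontr)
    assume "x \<notin> F"
    have Fn: "F \<subseteq> M" "finite F" "card F = k" using F M(4) by (auto simp: nsets_def)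
    have "card (M - F - {x}) = n - k - 1"
      using Fn M \<open>x \<notin> F\<close> by (simp add: card_Diff_subset)
    then have "l - 1 \<le> card (M - F - {x})" using assms by simp
    then obtain G where G: "G \<subseteq> M - F - {x}" "card G = l - 1" "finite G"
      using obtain_subset_with_card_n by metis
    then have "insert x G \<in> ?S"
      using M(3) assms(3) by (auto simp: nsets_def card_insert_if)
    then have "insert x G \<in> \<B>" using S by blast
    then have "F \<inter> insert x G \<noteq> {}" using F M(6) unfolding cross_intersecting_def by blast
    then show False using G \<open>x \<notin> F\<close> by blast
  qed
  obtain F where "F \<in> \<A>" using M(7) assms(4) by fastforce
  then have "x \<in> F" "finite F" "card F = k" using xA M(4) by (auto simp: nsets_def)
  then show "0 < k" by (auto simp: card_gt_0_iff)
  let ?A = "(\<lambda>F. F - {x}) ` \<A>" and ?B = "\<B> - ?S"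
  have "?A \<subseteq> nsets (M - {x}) (k - 1)"
  proof
    fix G assume "G \<in> ?A"
    then obtain F where F: "F \<in> \<A>" "G = F - {x}" by blast
    then have "F \<in> nsets M k" using M(4) by blast
    then show "G \<in> nsets (M - {x}) (k - 1)" using F xA[OF F(1)] by (auto simp: nsets_def)
  qed
  moreover have "?B \<subseteq> nsets (M - {x}) l" using M(5) by (auto simp: nsets_def)
  moreover have "cross_intersecting ?A ?B"
    unfolding cross_intersecting_def
  proof (intro ballI)
    fix F' G assume "F' \<in> ?A" and G: "G \<in> ?B"
    then obtain F where F: "F \<in> \<A>" "F' = F - {x}" by blast
    have "x \<notin> G" using G M(5) by blast
    moreover have "F \<inter> G \<noteq> {}" using F G M(6) unfolding cross_intersecting_def by blast
    ultimately show "F' \<inter> G \<noteq> {}" using F by blast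
  qed
  moreover have "card ?A = a" using card_remove_point[of \<A> x] xA M(7) by simp
  moreover have "card ?B = b - (n - 1 choose (l - 1))"
    using S cS M(8) fin by (subst card_Diff_subset) (auto intro: finite_subset)
  moreover have "finite (M - {x})" "card (M - {x}) = n - 1" using M by auto
  ultimately show "cross_pair (n - 1) (k - 1) l a (b - (n - 1 choose (l - 1)))"
    unfolding cross_pair_def by blast
qed

text \<open>A compressed \<open>\<B>\<close> no larger than the star of \<open>x\<close> lies inside
  it. Members of \<open>\<A>\<close> avoiding \<open>x\<close> meet the members of
  \<open>\<B>\<close> outside \<open>x\<close>; those through \<open>x\<close> are discarded, which
  costs at most a star.\<close>

lemma cross_pair_peel_small:
  assumes "cross_pair n k l a b" "0 < n" "0 < k" "0 < l" "b \<le> (n - 1 choose (l - 1))"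
  shows "cross_pair (n - 1) k (l - 1) (a - (n - 1 choose (k - 1))) b"
proof -
  obtain M :: "nat set" and \<A> \<B> x where M: "finite M" "card M = n" "x \<in> M" "\<A> \<subseteq> nsets M k"
    "\<B> \<subseteq> nsets M l" "cross_intersecting \<A> \<B>" "card \<A> = a" "card \<B> = b"
    and dich: "(\<forall>F\<in>\<B>. x \<in> F) \<or> {F \<in> nsets M l. x \<in> F} \<subseteq> \<B>"
    by (rule cross_pair_star[OF assms(1,2)]) (rule that; assumption)
  have fin: "finite (nsets M l)" "finite \<B>" "finite (nsets M k)" "finite \<A>"
    using M finite_imp_finite_nsets finite_subset by blast+
  have xB: "\<forall>F\<in>\<B>. x \<in> F"
  proof (cases "{F \<in> nsets M l. x \<in> F} \<subseteq> \<B>")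
    case True
    then have "{F \<in> nsets M l. x \<in> F} = \<B>"
      using card_seteq[of \<B> "{F \<in> nsets M l. x \<in> F}"] fin
        card_nsets_star[OF M(1,3) assms(4)] M(2,8) assms(5) by simp
    then show ?thesis by blast
  qed (use dich in blast)
  let ?A = "{F \<in> \<A>. x \<notin> F}" and ?B = "(\<lambda>F. F - {x}) ` \<B>"
  have "?A \<subseteq> nsets (M - {x}) k" using M(4) by (auto simp: nsets_def)
  moreover have "?B \<subseteq> nsets (M - {x}) (l - 1)"
    using xB M(5) by (auto simp: nsets_def)
  moreover have "cross_intersecting ?A ?B"
    unfolding cross_intersecting_def
  proof (intro ballI)
    fix F G' assume F: "F \<in> ?A" and "G' \<in> ?B"
    then obtain G where G: "G \<in> \<B>" "G' = G - {x}" by blast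
    have "F \<inter> G \<noteq> {}" using F G M(6) unfolding cross_intersecting_def by blast
    then show "F \<inter> G' \<noteq> {}" using F G by blast
  qed
  moreover have "card ?B = b" using card_remove_point[OF xB] M(8) by simp
  moreover have "finite (M - {x})" "card (M - {x}) = n - 1" using M by auto
  ultimately have "cross_pair (n - 1) k (l - 1) (card ?A) b"
    unfolding cross_pair_def by blast
  moreover have "a - (n - 1 choose (k - 1)) \<le> card ?A"
  proof -
    have "\<A> = ?A \<union> {F \<in> \<A>. x \<in> F}" by blast
    then have "a \<le> card ?A + card {F \<in> \<A>. x \<in> F}"
      using card_Un_le[of ?A "{F \<in> \<A>. x \<in> F}"] M(7) by simp
    moreover have "card {F \<in> \<A>. x \<in> F} \<le> card {F \<in> nsets M k. x \<in> F}"
      using M(4) fin by (intro card_mono) auto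
    ultimately show ?thesis
      using card_nsets_star[OF M(1,3) assms(3)] M(2) by simp
  qed
  ultimately show ?thesis using cross_pair_mono by blast
qed

section \<open>Inequalities for binomial coefficients\<close>

text \<open>The quotient of \<open>m choose q\<close> by \<open>m choose p\<close> grows with
  \<open>m\<close>: up to the factor \<open>q choose p\<close> it is
  \<open>m - p choose (q - p)\<close>.\<close>

lemma choose_ratio_mono:
  assumes "p \<le> q" "m \<le> M"
  shows "(M choose p) * (m choose q) \<le> (M choose q) * (m choose p)"
proof (cases "q \<le> m")
  case True
  have "(M choose p) * (m choose q) * (q choose p) =
      (M choose p) * (m choose p) * (m - p choose (q - p))"
    using choose_mult[of p q m] assms True by simp
  also have "\<dots> \<le> (M choose p) * (m choose p) * (M - p choose (q - p))"
    using assms by (intro mult_le_mono2 binomial_right_mono) simp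
  also have "\<dots> = (M choose q) * (m choose p) * (q choose p)"
    using choose_mult[of p q M] assms True by simp
  finally show ?thesis using assms by simp
qed (simp add: binomial_eq_0)

lemma choose_add_le:
  "(p + x + y choose p) \<le> (p + x choose p) * (p + y choose p)"
proof (induction p)
  case (Suc p)
  have poly: "Suc p * (Suc p + x + y) \<le> (Suc p + x) * (Suc p + y)" by (simp add: algebra_simps)
  have step: "Suc p * (Suc p + z choose Suc p) = (Suc p + z) * (p + z choose p)" for z
    using Suc_times_binomial[of p "p + z"] by simp
  have "Suc p * Suc p * (Suc p + x + y choose Suc p) =
      Suc p * (Suc p + x + y) * (p + x + y choose p)"
    using step[of "x + y"] by (simp only: add.assoc mult.assoc)
  also have "\<dots> \<le> ((Suc p + x) * (Suc p + y)) * ((p + x choose p) * (p + y choose p))"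
    by (rule mult_le_mono[OF poly Suc.IH])
  also have "\<dots> = (Suc p * (Suc p + x choose Suc p)) * (Suc p * (Suc p + y choose Suc p))"
    unfolding step by (simp only: mult_ac)
  also have "\<dots> = Suc p * Suc p * ((Suc p + x choose Suc p) * (Suc p + y choose Suc p))"
    by (simp only: mult_ac)
  finally show ?case by (rule mult_left_le_imp_le) simp
qed simp

text \<open>Unimodality: \<open>i\<close> is at most both \<open>j\<close> and \<open>n - j\<close>,
  one of which is not past the middle.\<close>

lemma choose_le_choose:
  fixes n i j :: nat
  assumes "i \<le> j" "i + j \<le> n"
  shows "(n choose i) \<le> (n choose j)"
proof (cases "2 * j \<le> n")
  case True
  then show ?thesis using binomial_mono assms by blast
next
  case False
  have "(n choose i) \<le> (n choose (n - j))"
    using assms False by (intro binomial_mono) auto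
  then show ?thesis using assms by (simp add: binomial_symmetric[of j n])
qed

lemma sum_choose_upper:
  "(\<Sum>j<s. m + j choose p) + (m choose Suc p) = (m + s choose Suc p)"
  by (induction s) auto

lemma sum_choose_diagonal:
  "(\<Sum>j<s. m + j choose (Suc q + j)) + (m choose q) = (m + s choose (q + s))"
  by (induction s) auto


text \<open>Slope of the product along the segment from \<open>(r, s)\<close> to \<open>(r, s - 1)\<close>, with \<open>m = n - r - s\<close>,
  \<open>p = k - r - 1\<close> and \<open>q = l - s + 1\<close>.\<close>
lemma slope_ge3:
  assumes pq: "p + q \<le> m" and p: "p \<le> q + s - 3" and "0 < q" "3 \<le> s"
  shows "(\<Sum>j<s. m + j choose p) * (m choose q) \<le>
         (m choose p) * ((m + s choose (q + s - 2)) + (m choose (q - 1)))"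
\<comment> \<open>Past the middle, comparison along a diagonal gives
  \<open>m + s choose (q + s - 1)\<close>, which is at most \<open>m + s choose (q + s - 2)\<close>.
  Before the middle, \<open>m choose q\<close> is first raised to
  \<open>m choose (q + s - 3)\<close>, and the comparison runs along a column.\<close>
proof (cases "m + s \<le> 2 * (q + s - 1) - 1")
  case True
  have term_le: "(m + j choose p) * (m choose q) \<le> (m + j choose (q + j)) * (m choose p)" for j
  proof -
    \<comment> \<open>Passing to complements gives both tops the same lower index:
      \<open>m - q\<close> is complementary to \<open>q\<close> in \<open>m\<close> and to
      \<open>q + j\<close> in \<open>m + j\<close>.\<close>
    have "(m + j choose p) * (m choose (m - q)) \<le> (m + j choose (m - q)) * (m choose p)"
      using pq by (intro choose_ratio_mono) auto
    then show ?thesis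
      using binomial_symmetric[of q m] binomial_symmetric[of "q + j" "m + j"] pq by simp
  qed
  have "(\<Sum>j<s. m + j choose p) * (m choose q) \<le> (\<Sum>j<s. m + j choose (q + j)) * (m choose p)"
    unfolding sum_distrib_right by (intro sum_mono term_le)
  also have "(\<Sum>j<s. m + j choose (q + j)) \<le> (m + s choose (q - 1 + s))"
    using sum_choose_diagonal[where s = s and m = m and q = "q - 1"] \<open>0 < q\<close> by simp
  also have "(m + s choose (q - 1 + s)) \<le> (m + s choose (q + s - 2))"
  proof (cases "q - 1 + s \<le> m + s")
    case le: True
    have "(m + s choose (m + s - (q - 1 + s))) \<le> (m + s choose (q + s - 2))"
      using True le \<open>0 < q\<close> \<open>3 \<le> s\<close> pq by (intro choose_le_choose) auto
    then show ?thesis using binomial_symmetric[OF le] by simp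
  qed (simp add: binomial_eq_0)
  finally show ?thesis by (simp add: algebra_simps)
next
  case False
  let ?t = "q + s - 3"
  have t: "q + s - 2 = Suc ?t" using assms by simp
  have "(\<Sum>j<s. m + j choose p) * (m choose q) \<le> (\<Sum>j<s. m + j choose p) * (m choose ?t)"
    using assms False by (intro mult_le_mono2 choose_le_choose) auto
  also have "\<dots> \<le> (\<Sum>j<s. m + j choose ?t) * (m choose p)"
    unfolding sum_distrib_right using p by (intro sum_mono choose_ratio_mono) auto
  also have "(\<Sum>j<s. m + j choose ?t) \<le> (m + s choose (q + s - 2))"
    using sum_choose_upper[where m = m and s = s and p = ?t] unfolding t by simp
  finally show ?thesis by (simp add: algebra_simps)
qed

lemma slope_2:
  assumes "p \<le> q"
  shows "((m choose p) + (m + 1 choose p)) * (m choose q) \<le>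
         (m choose p) * ((m + 2 choose q) + (m + 2 choose q))"
proof -
  have 1: "(m + 1 choose p) * (m choose q) \<le> (m choose p) * (m + 1 choose q)"
    using choose_ratio_mono[of p q m "m + 1"] assms by (simp add: mult.commute)
  have "((m choose p) + (m + 1 choose p)) * (m choose q) \<le>
      (m choose p) * ((m choose q) + (m + 1 choose q))"
    using 1 by (simp add: algebra_simps)
  also have "\<dots> \<le> (m choose p) * ((m + 2 choose q) + (m + 2 choose q))"
    by (intro mult_le_mono2 add_mono binomial_right_mono) auto
  finally show ?thesis .
qed

text \<open>Writing \<open>m = p + l + d\<close> with \<open>d\<close> the slack in
  \<open>k + l \<le> n\<close>, submultiplicativity splits off the factor
  \<open>m - l choose p\<close>. The other factor \<open>p + l choose p\<close> is at most
  \<open>p + l choose (l - 1)\<close> because \<open>p < l\<close>.\<close>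

lemma star_step_choose:
  assumes "p < k" "k \<le> l" "k + l \<le> n" "m + (k - p) = n" 
  shows "(m choose p) \<le> (m - l choose p) * (n - 1 choose (l - 1))"
proof -
  define d where "d = n - k - l"
  have m: "m = p + l + d" using assms d_def by simp
  have "(m choose p) \<le> (p + l choose p) * (p + d choose p)"
    unfolding m by (rule choose_add_le)
  also have "(p + d choose p) = (m - l choose p)" using m by simp
  also have "(p + l choose p) \<le> (p + l choose Suc p)"
    using assms by (intro choose_le_choose) auto
  also have "(p + l choose Suc p) = (p + l choose (l - 1))"
    using assms binomial_symmetric[of "Suc p" "p + l"] by simp
  also have "\<dots> \<le> (n - 1 choose (l - 1))"
    using assms by (intro binomial_right_mono) auto
  finally show ?thesis by (simp add: mult.commute)
qed

section \<open>Monotonicity of the product\<close>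

lemma cross_pair_peel_large_iter:
  assumes "cross_pair n k l a b" "k + l \<le> n" "0 < l" "0 < a" "(\<Sum>i=1..r. n - i choose (l - 1)) \<le> b"
  shows "r \<le> k \<and> cross_pair (n - r) (k - r) l a (b - (\<Sum>i=1..r. n - i choose (l - 1)))"
  using assms(5)
proof (induction r)
  case 0
  then show ?case using assms by simp
next
  case (Suc r)
  let ?S = "\<Sum>i=1..r. n - i choose (l - 1)"
  have IH: "r \<le> k" "cross_pair (n - r) (k - r) l a (b - ?S)"
    using Suc by auto
  have "k - r + l \<le> n - r" "(n - r - 1 choose (l - 1)) \<le> b - ?S"
    using IH(1) assms(2) Suc.prems by auto
  from cross_pair_peel_large[OF IH(2) this(1) assms(3,4) this(2)]
  show ?case by (simp add: diff_diff_left)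
qed

text \<open>The losses \<open>n - i choose (k - 1)\<close> for \<open>i = 1, ..., s\<close> add up
  by Pascal's rule. The condition on \<open>b\<close> is strongest at the last step.\<close>

lemma cross_pair_peel_small_iter:
  assumes "cross_pair n k l a b" "k + l \<le> n" "0 < k" "s \<le> l" "b \<le> (n - s choose (l - s))"
  shows "cross_pair (n - s) k (l - s) (a - ((n choose k) - (n - s choose k))) b"
  using assms(4,5)
proof (induction s)
  case 0
  then show ?case using assms by simp
next
  case (Suc s)
  have ns: "n - s = Suc (n - Suc s)" "l - s = Suc (l - Suc s)" "k = Suc (k - 1)"
    using Suc.prems assms by auto
  have "(n - Suc s choose (l - Suc s)) \<le> (n - s choose (l - s))"
    unfolding ns by simp
  then have IH: "cross_pair (n - s) k (l - s) (a - ((n choose k) - (n - s choose k))) b"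
    using Suc by auto
  have "cross_pair (n - s - 1) k (l - s - 1)
      (a - ((n choose k) - (n - s choose k)) - (n - s - 1 choose (k - 1))) b"
    using cross_pair_peel_small[OF IH] ns assms(3) Suc.prems by simp
  moreover have "(n - s choose k) = (n - Suc s choose k) + (n - Suc s choose (k - 1))"
    unfolding ns(1) by (subst (1 2) ns(3)) simp
  moreover have "(n - s choose k) \<le> (n choose k)" by (intro binomial_right_mono) simp
  ultimately show ?case by (simp add: diff_diff_left)
qed

text \<open>After \<open>k\<close> peelings a nonempty first family would consist of the empty set,
  leaving no room for a nonempty second one.\<close>

lemma cross_pair_empty:
  assumes "cross_pair n k l a b" "k + l \<le> n" "0 < l" "(\<Sum>i=1..k. n - i choose (l - 1)) < b"
  shows "a = 0"
proof (rule ccontr)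
  assume "a \<noteq> 0"
  then have "cross_pair (n - k) 0 l a (b - (\<Sum>i=1..k. n - i choose (l - 1)))" (is "cross_pair _ _ _ _ ?b")
    using cross_pair_peel_large_iter[OF assms(1-3), of k] assms(4) by simp
  then have "a * (n - k choose l) + ?b \<le> (n - k choose l)"
    using cross_pair_LYM[of "n - k" 0 l a ?b] assms(2) by simp
  moreover have "(n - k choose l) \<le> a * (n - k choose l)" using \<open>a \<noteq> 0\<close> by simp
  ultimately have "?b = 0" by linarith
  then show False using assms(4) by simp
qed

lemma cross_pair_star_LYM:
  assumes "cross_pair n k l a b" "k + l \<le> n" "0 < k" "0 < l" "(n - 1 choose (l - 1)) \<le> b"
  shows "a * (n - 1 choose l) + (b - (n - 1 choose (l - 1))) * (n - 1 choose (k - 1)) \<le>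
         (n - 1 choose (k - 1)) * (n - 1 choose l)"
proof (cases "a = 0")
  case True
  have "b \<le> (n choose l)" using cross_pair_le_choose[OF assms(1)] by simp
  also have "(n choose l) = (n - 1 choose (l - 1)) + (n - 1 choose l)"
    using assms choose_reduce_nat by simp
  finally have "b - (n - 1 choose (l - 1)) \<le> (n - 1 choose l)" by simp
  from mult_le_mono1[OF this, of "n - 1 choose (k - 1)"] show ?thesis
    unfolding True by (simp add: mult.commute)
next
  case False
  then have "0 < a" by simp
  then have "cross_pair (n - 1) (k - 1) l a (b - (n - 1 choose (l - 1)))"
    by (rule cross_pair_peel_large(2)[OF assms(1,2,4) _ assms(5)])
  moreover have "k - 1 + l \<le> n - 1" using assms(2,3) by simp
  ultimately show ?thesis by (rule cross_pair_LYM)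
qed

section \<open>The extremal sizes and the segments between them\<close>

definition extremal_A :: "nat \<Rightarrow> nat \<Rightarrow> nat \<Rightarrow> nat \<Rightarrow> nat" where
  "extremal_A n k r s = (n - r choose (k - r)) - (n - r - s choose (k - r))"

definition extremal_B :: "nat \<Rightarrow> nat \<Rightarrow> nat \<Rightarrow> nat \<Rightarrow> nat" where
  "extremal_B n l r s = (\<Sum>i=1..r. n - i choose (l - 1)) + (n - r - s choose (l - s))"

definition product_bound :: "nat \<Rightarrow> nat \<Rightarrow> nat \<Rightarrow> nat \<Rightarrow> nat \<Rightarrow> bool" where
  "product_bound n k l r s \<longleftrightarrow>
     (\<forall>a b. cross_pair n k l a b \<longrightarrow> extremal_B n l r s \<le> b \<longrightarrow>
        a * b \<le> extremal_A n k r s * extremal_B n l r s)"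

text \<open>Start of the descent: more than \<open>k\<close> successive stars in the second family
  force the first to be empty.\<close>

lemma product_bound_ge:
  assumes "k + l \<le> n" "0 < k" "0 < l" "s \<le> l" "k \<le> r" "r \<le> n - l"
  shows "product_bound n k l r s"
  unfolding product_bound_def
proof (intro allI impI)
  fix a b assume cp: "cross_pair n k l a b" and b: "extremal_B n l r s \<le> b"
  have "(\<Sum>i=1..k. n - i choose (l - 1)) < extremal_B n l r s"
  proof (cases "k = r")
    case True
    then have "l - s \<le> n - r - s" using assms by simp
    then show ?thesis unfolding extremal_B_def True by simp
  next
    case False
    have "{1..r} = {1..k} \<union> {Suc k..r}" "{1..k} \<inter> {Suc k..r} = {}" using assms by auto
    then have "(\<Sum>i=1..r. n - i choose (l - 1)) =
        (\<Sum>i=1..k. n - i choose (l - 1)) + (\<Sum>i=Suc k..r. n - i choose (l - 1))"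
      by (metis finite_atLeastAtMost sum.union_disjoint)
    moreover have "0 < (\<Sum>i=Suc k..r. n - i choose (l - 1))"
      using False assms by (intro sum_pos) auto
    ultimately show ?thesis unfolding extremal_B_def by simp
  qed
  then have "a = 0" using cross_pair_empty[OF cp assms(1,3)] b by simp
  then show "a * b \<le> extremal_A n k r s * extremal_B n l r s" by simp
qed

text \<open>Peel \<open>r\<close> points in the large case and \<open>s - 1\<close> in the small
  case; the star form of LYM removes one more, leaving \<open>n - r - s\<close>.\<close>

lemma segment_bound:
  assumes "cross_pair n k l a b" "k + l \<le> n" "r < k" "2 \<le> s" "s \<le> l"
    and "extremal_B n l r s \<le> b" "b \<le> extremal_B n l r (s - 1)"
  shows "(a - extremal_A n k r (s - 1)) * (n - r - s choose (l - s + 1)) +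
           (b - extremal_B n l r s) * (n - r - s choose (k - r - 1)) \<le>
         (n - r - s choose (k - r - 1)) * (n - r - s choose (l - s + 1))"
proof -
  let ?S = "\<Sum>i=1..r. n - i choose (l - 1)"
  have *: "n - r - (s - 1) = Suc (n - r - s)" "l - (s - 1) = Suc (l - s)"
    using assms by auto
  have swap: "f * C \<le> C * C'" if "f \<le> C'" for f C C' :: nat
    using that by (metis mult.commute mult_le_mono2)
  show ?thesis
  proof (cases "a = 0")
    case True
    have "y - (x + z) \<le> w" if "y \<le> x + (z + w)" for x y z w :: nat using that by simp
    from this[OF assms(7)[unfolded extremal_B_def * binomial_Suc_Suc]]
    have "b - extremal_B n l r s \<le> (n - r - s choose (l - s + 1))"
      unfolding extremal_B_def by simp
    from swap[OF this] show ?thesis unfolding True diff_0_eq_0 mult_0 add_0 .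
  next
    case False
    then have pos: "0 < a" "0 < l" using assms(4,5) by simp_all
    have S: "?S \<le> b" using assms(6) unfolding extremal_B_def by (rule add_leD1)
    have cp1: "cross_pair (n - r) (k - r) l a (b - ?S)"
      using cross_pair_peel_large_iter[OF assms(1,2) pos(2,1) S] by blast
    have dims: "k - r + l \<le> n - r" "0 < k - r" "s - 1 \<le> l"
      "k - r + (l - (s - 1)) \<le> n - r - (s - 1)" "0 < l - (s - 1)"
      using assms(2-5) by auto
    have "y - x \<le> z" if "y \<le> x + z" for x y z :: nat using that by simp
    from this[OF assms(7)[unfolded extremal_B_def]]
    have cp2: "cross_pair (n - r - (s - 1)) (k - r) (l - (s - 1))
        (a - extremal_A n k r (s - 1)) (b - ?S)"
      unfolding extremal_A_def by (rule cross_pair_peel_small_iter[OF cp1 dims(1-3)])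
    have eqs: "n - r - (s - 1) - 1 = n - r - s" "l - (s - 1) - 1 = l - s" "l - (s - 1) = l - s + 1"
      unfolding * by simp_all
    have "z \<le> y - x" if "x + z \<le> y" for x y z :: nat using that by simp
    from this[OF assms(6)[unfolded extremal_B_def]]
    have "(n - r - (s - 1) - 1 choose (l - (s - 1) - 1)) \<le> b - ?S" unfolding eqs(1,2) .
    note LYM = cross_pair_star_LYM[OF cp2 dims(4,2,5) this]
    have "b - ?S - (n - r - s choose (l - s)) = b - extremal_B n l r s"
      unfolding extremal_B_def by (rule diff_diff_left)
    then show ?thesis using LYM unfolding eqs(1,2) by (simp only: eqs(3))
  qed
qed

lemma extremal_A_step:
  assumes "r < k" "r + s \<le> n" "0 < s"
  shows "extremal_A n k r s = extremal_A n k r (s - 1) + (n - r - s choose (k - r - 1))"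
proof -
  obtain p where p: "k - r = Suc p" using assms(1) by (cases "k - r") auto
  have *: "n - r - (s - 1) = Suc (n - r - s)" "k - r - 1 = p" using assms p by auto
  have "(Suc (n - r - s) choose Suc p) \<le> (n - r choose Suc p)"
    using assms by (intro binomial_right_mono) simp
  then show ?thesis unfolding extremal_A_def * unfolding p by simp
qed

lemma extremal_B_step:
  assumes "0 < s" "s \<le> l" "r + s \<le> n"
  shows "extremal_B n l r (s - 1) = extremal_B n l r s + (n - r - s choose (l - s + 1))"
proof -
  have *: "n - r - (s - 1) = Suc (n - r - s)" "l - (s - 1) = Suc (l - s)"
    using assms by auto
  show ?thesis unfolding extremal_B_def * by simp
qed

lemma sum_last:
  fixes f :: "nat \<Rightarrow> nat"
  assumes "1 \<le> r"
  shows "(\<Sum>i=1..r. f i) = (\<Sum>i=1..r - 1. f i) + f r"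
  using assms by (cases r) auto

text \<open>The first size is a column sum, and of the second only the end is kept: the summand
  \<open>i = r\<close> with the final coefficient if \<open>s \<ge> 3\<close>, the summands
  \<open>i = r - 1\<close> and \<open>i = r\<close> if \<open>s = 2\<close>. The latter pair is
  missing for \<open>(1, 2)\<close>.\<close>

lemma extremal_slope:
  assumes "k \<le> l" "k + l \<le> n" "1 \<le> r" "r < k" "2 \<le> s" "s \<le> l" "(r, s) \<noteq> (1, 2)"
  shows "extremal_A n k r s * (n - r - s choose (l - s + 1)) \<le>
         extremal_B n l r s * (n - r - s choose (k - r - 1))"
proof -
  let ?m = "n - r - s" and ?p = "k - r - 1" and ?q = "l - s + 1"
  have A: "extremal_A n k r s = (\<Sum>j<s. ?m + j choose ?p)"
  proof -
    have e: "?m + s = n - r" "Suc ?p = k - r" using assms by auto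
    have "extremal_A n k r s = (?m + s choose Suc ?p) - (?m choose Suc ?p)"
      unfolding extremal_A_def e ..
    then show ?thesis unfolding sum_choose_upper[of ?m ?p s, symmetric] by simp
  qed
  note last = sum_last[OF assms(3), of "\<lambda>i. n - i choose (l - 1)"]
  show ?thesis
  proof (cases "s = 2")
    case False
    have "extremal_A n k r s * (?m choose ?q) \<le>
        (?m choose ?p) * ((?m + s choose (?q + s - 2)) + (?m choose (?q - 1)))"
    proof -
      have "?p + ?q \<le> ?m" "?p \<le> ?q + s - 3" "0 < ?q" "3 \<le> s" using assms(1-6) False by auto
      then show ?thesis unfolding A by (rule slope_ge3)
    qed
    also have "(?m + s choose (?q + s - 2)) + (?m choose (?q - 1)) \<le> extremal_B n l r s"
    proof -
      have "?m + s = n - r" "?q + s - 2 = l - 1" "?q - 1 = l - s" using assms by auto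
      then show ?thesis unfolding extremal_B_def last by (simp only: add.assoc le_add2)
    qed
    finally show ?thesis by (simp add: mult.commute)
  next
    case True
    then have r: "2 \<le> r" using assms by auto
    have last2: "(\<Sum>i=1..r - 1. n - i choose (l - 1)) =
        (\<Sum>i=1..r - 1 - 1. n - i choose (l - 1)) + (n - (r - 1) choose (l - 1))"
      by (rule sum_last) (use r in simp)
    have "extremal_A n k r s * (?m choose ?q) =
        ((?m choose ?p) + (?m + 1 choose ?p)) * (?m choose ?q)"
      unfolding A unfolding True by (simp add: numeral_2_eq_2)
    also have "\<dots> \<le> (?m choose ?p) * ((?m + 2 choose ?q) + (?m + 2 choose ?q))"
      using assms True by (intro slope_2) auto
    also have "(?m + 2 choose ?q) + (?m + 2 choose ?q) \<le> extremal_B n l r s"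
    proof -
      have "?m + 2 = n - r" "?q = l - 1" using True assms by auto
      moreover have "(n - r choose (l - 1)) \<le> (n - (r - 1) choose (l - 1))"
        by (intro binomial_right_mono) simp
      moreover have "x + x \<le> w + x' + x + y" if "x \<le> x'" for w x x' y :: nat using that by simp
      ultimately show ?thesis unfolding extremal_B_def last last2 by metis
    qed
    finally show ?thesis by (simp add: mult.commute)
  qed
qed

text \<open>A bound linear in the gain \<open>f\<close> and the loss \<open>e\<close> makes the product a quadratic in \<open>f\<close>
  whose slope at \<open>f = 0\<close> is nonpositive.\<close>
lemma trade_off:
  fixes a a0 b b0 C C' e f :: nat
  assumes slope: "a0 * C' \<le> b0 * C" and "C * f \<le> C' * e" "0 < C"
    and "a + e \<le> a0" "b = b0 + f"
  shows "a * b \<le> a0 * b0"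
proof -
  have "C * (a0 * f) \<le> a0 * (C' * e)" using assms(2) by (metis mult.left_commute mult_le_mono2)
  also have "\<dots> \<le> C * (b0 * e)"
    using mult_le_mono1[OF slope, of e] by (simp add: mult_ac)
  finally have 1: "a0 * f \<le> b0 * e" using assms(3) by simp
  have "a * b + b0 * e = (a + e) * b0 + a * f" using assms(5) by (simp add: algebra_simps)
  also have "\<dots> \<le> a0 * b0 + a0 * f"
    using assms(4) by (intro add_mono mult_le_mono) auto
  also have "\<dots> \<le> a0 * b0 + b0 * e" using 1 by simp
  finally show ?thesis by simp
qed

lemma product_bound_step:
  assumes "k \<le> l" "k + l \<le> n" "1 \<le> r" "r < k" "2 \<le> s" "s \<le> l" "(r, s) \<noteq> (1, 2)"
    and prev: "product_bound n k l r (s - 1)"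
  shows "product_bound n k l r s"
  unfolding product_bound_def
proof (intro allI impI)
  fix a b assume cp: "cross_pair n k l a b" and b: "extremal_B n l r s \<le> b"
  let ?C = "n - r - s choose (k - r - 1)" and ?C' = "n - r - s choose (l - s + 1)"
  note slope = extremal_slope[OF assms(1-7)]
  have C: "0 < ?C" using assms by simp
  have Astep: "extremal_A n k r s = extremal_A n k r (s - 1) + ?C"
    using assms by (intro extremal_A_step) auto
  have Bstep: "extremal_B n l r (s - 1) = extremal_B n l r s + ?C'"
    using assms by (intro extremal_B_step) auto
  show "a * b \<le> extremal_A n k r s * extremal_B n l r s"
  proof (cases "extremal_B n l r (s - 1) \<le> b")
    case True
    then have "a * b \<le> extremal_A n k r (s - 1) * extremal_B n l r (s - 1)"
      using prev cp by (simp add: product_bound_def)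
    also have "\<dots> \<le> extremal_A n k r s * extremal_B n l r s"
      \<comment> \<open>The whole segment is a trade with gain \<open>?C'\<close> and loss
        \<open>?C\<close>.\<close>
      by (rule trade_off[OF slope _ C, of ?C' ?C]) (use Astep Bstep in auto)
    finally show ?thesis .
  next
    case False
    let ?X = "a - extremal_A n k r (s - 1)" and ?f = "b - extremal_B n l r s"
    have seg: "?X * ?C' + ?f * ?C \<le> ?C * ?C'"
      using segment_bound[OF cp assms(2,4-6) b] False by simp
    have C': "0 < ?C'" using assms by simp
    have "?X * ?C' \<le> ?C * ?C'" using seg by linarith
    then have "?X \<le> ?C" using C' by simp
    \<comment> \<open>The number \<open>e\<close> is the loss in the first family that LYM forces
      for the gain \<open>?f\<close>.\<close>
    then obtain e where e: "?C = ?X + e" using le_Suc_ex by blast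
    have "?C * ?C' = ?X * ?C' + ?C' * e" by (subst e) (simp add: algebra_simps)
    then have "?C * ?f \<le> ?C' * e" using seg by (simp add: mult.commute)
    moreover have "x \<le> y + (x - y)" for x y :: nat by simp
    then have "a + e \<le> extremal_A n k r s"
      unfolding Astep e add.assoc[symmetric] by (rule add_right_mono)
    ultimately show ?thesis
      using trade_off[OF slope _ C _ le_add_diff_inverse[OF b, symmetric]] by blast
  qed
qed

lemma product_bound_star:
  assumes "k \<le> l" "k + l \<le> n" "r < k"
    and prev: "product_bound n k l (Suc r) l"
  shows "product_bound n k l r 1"
  unfolding product_bound_def
proof (intro allI impI)
  fix a b assume cp: "cross_pair n k l a b" and b: "extremal_B n l r 1 \<le> b"
  let ?m = "n - Suc r" and ?p = "k - Suc r" and ?b0 = "extremal_B n l r 1"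
  have l: "0 < l" using assms by simp
  \<comment> \<open>For \<open>s = 1\<close> the last coefficient is the summand
    \<open>i = r + 1\<close>, so the second family has the size of \<open>r + 1\<close> successive
    stars.\<close>
  have b0: "?b0 = (\<Sum>i=1..Suc r. n - i choose (l - 1))" by (simp add: extremal_B_def)
  have A0: "extremal_A n k r 1 = (?m choose ?p)"
  proof -
    have "n - r = Suc ?m" "k - r = Suc ?p" using assms by auto
    then show ?thesis by (simp add: extremal_A_def)
  qed
  show "a * b \<le> extremal_A n k r 1 * ?b0"
  proof (cases "a = 0")
    case False
    then have cp': "cross_pair ?m ?p l a (b - ?b0)"
      using cross_pair_peel_large_iter[OF cp assms(2) l, of "Suc r"] b unfolding b0 by simp
    show ?thesis
    proof (cases "b = ?b0")
      case True
      have "a \<le> (?m choose ?p)" using cross_pair_le_choose[OF cp'] by simp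
      then show ?thesis using True A0 by simp
    next
      case gt: False
      \<comment> \<open>The last coefficient has lower index 0, hence value 1: exceeding
        \<open>?b0\<close> already means reaching the pair \<open>(r + 1, l)\<close>.\<close>
      have "extremal_B n l (Suc r) l = ?b0 + 1"
        unfolding b0 by (simp add: extremal_B_def)
      then have "a * b \<le> extremal_A n k (Suc r) l * (?b0 + 1)"
        using prev cp b gt unfolding product_bound_def by (metis Suc_eq_plus1 le_neq_implies_less Suc_leI)
      also have "extremal_A n k (Suc r) l = (?m choose ?p) - (?m - l choose ?p)"
        by (simp add: extremal_A_def)
      also have "((?m choose ?p) - (?m - l choose ?p)) * (?b0 + 1) \<le> (?m choose ?p) * ?b0"
      proof -
        have "(n - 1 choose (l - 1)) \<le> ?b0"
          unfolding b0 by (subst sum.atLeast_Suc_atMost) auto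
        then have "(?m - l choose ?p) * (n - 1 choose (l - 1)) \<le> (?m - l choose ?p) * (?b0 + 1)"
          by (intro mult_le_mono2) simp
        moreover have "(?m choose ?p) \<le> (?m - l choose ?p) * (n - 1 choose (l - 1))"
          using assms by (intro star_step_choose) auto
        moreover have "(x - y) * (c + 1) \<le> x * c" if "x \<le> y * (c + 1)" for x y c :: nat
          using that unfolding diff_mult_distrib by (simp only: distrib_left mult_1_right)
        ultimately show ?thesis using le_trans by blast
      qed
      finally show ?thesis unfolding A0 .
    qed
  qed simp
qed

text \<open>For \<open>(r, s) = (1, 2)\<close> the linear bound is too weak. Writing \<open>a = D + \<alpha>\<close> and \<open>b = E + \<beta>\<close>
  with \<open>D, E\<close> constant, it controls \<open>D * \<beta> + E * \<alpha>\<close>, while \<open>\<alpha> * \<beta>\<close> is a smaller instance of the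
  product bound.\<close>
lemma product_bound_1_2:
  assumes "k \<le> l" "k + l \<le> n" "2 \<le> k"
    and prev: "product_bound n k l 1 1"
    and smaller: "product_bound (n - 2) (k - 1) (l - 1) 0 1"
  shows "product_bound n k l 1 2"
  unfolding product_bound_def
proof (intro allI impI)
  fix a b assume cp: "cross_pair n k l a b" and b: "extremal_B n l 1 2 \<le> b"
  define N p q where "N = n - 3" and "p = k - 2" and "q = l - 2"
  have n: "n = Suc (Suc (Suc N))" and k: "k = Suc (Suc p)" and l: "l = Suc (Suc q)"
    using assms unfolding N_def p_def q_def by auto
  have pq: "p \<le> q" "p + q + 1 \<le> N" using assms n k l by auto
  define D E G \<alpha>0 \<beta>0 where "D = (Suc N choose p)" and "E = (Suc (Suc N) choose Suc q)"
    and "G = (N choose Suc q)" and "\<alpha>0 = (N choose p)" and "\<beta>0 = (N choose q)"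
  note defs = D_def E_def G_def \<alpha>0_def \<beta>0_def
  have A2: "extremal_A n k 1 2 = D + \<alpha>0" and A1: "extremal_A n k 1 1 = D"
    and B2: "extremal_B n l 1 2 = E + \<beta>0" and B1: "extremal_B n l 1 1 = E + \<beta>0 + G"
    unfolding extremal_A_def extremal_B_def defs n k l by simp_all
  have "D * G \<le> (Suc N choose Suc q) * \<alpha>0"
    unfolding defs using pq by (intro choose_ratio_mono) auto
  also have "\<dots> \<le> E * \<alpha>0"
    unfolding E_def by (intro mult_le_mono1 binomial_right_mono) simp
  finally have DG: "D * G \<le> E * \<alpha>0" .
  have \<alpha>0: "0 < \<alpha>0" unfolding \<alpha>0_def using pq by simp
  have "a * b \<le> (D + \<alpha>0) * (E + \<beta>0)"
  proof (cases "extremal_B n l 1 1 \<le> b \<or> a = 0")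
    case True
    then have "a * b \<le> D * (E + \<beta>0 + G)"
      using prev cp unfolding product_bound_def A1 B1 by auto
    also have "\<dots> \<le> (D + \<alpha>0) * (E + \<beta>0)" using DG by (simp add: algebra_simps)
    finally show ?thesis .
  next
    case False
    define \<alpha> \<beta> where "\<alpha> = a - D" and "\<beta> = b - E"
    have b_eq: "b = E + \<beta>" using b B2 \<beta>_def by simp
    have \<beta>: "\<beta>0 \<le> \<beta>" "\<beta> \<le> \<beta>0 + G" using b False B1 B2 \<beta>_def by auto
    have "cross_pair (n - 1) (k - 1) l a (b - E)"
      using cross_pair_peel_large(2)[OF cp assms(2)] False b B2 unfolding E_def n k l by simp
    \<comment> \<open>One point is removed in the large case (leaving \<open>\<beta>\<close>) and
      one in the small case (leaving \<open>\<alpha>\<close>).\<close>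
    then have cp1: "cross_pair (Suc N) (Suc p) (Suc q) \<alpha> \<beta>"
      using cross_pair_peel_small[of "Suc (Suc N)" "Suc p" l a \<beta>] \<beta>
      unfolding \<alpha>_def D_def \<beta>_def[symmetric] n k l \<beta>0_def G_def by simp
    have "\<alpha> * \<beta> \<le> extremal_A (n - 2) (k - 1) 0 1 * extremal_B (n - 2) (l - 1) 0 1"
      using smaller cp1 \<beta> unfolding product_bound_def
      by (auto simp: n k l extremal_B_def \<beta>0_def)
    then have prod: "\<alpha> * \<beta> \<le> \<alpha>0 * \<beta>0"
      by (simp add: n k l extremal_A_def extremal_B_def \<alpha>0_def \<beta>0_def)
    have lym: "\<alpha> * G + (\<beta> - \<beta>0) * \<alpha>0 \<le> \<alpha>0 * G"
      using cross_pair_star_LYM[OF cp1] \<beta> pq unfolding defs by simp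
    obtain f where f: "\<beta> = \<beta>0 + f" using \<beta> le_Suc_ex by blast
    have "\<alpha>0 * (D * f + E * \<alpha>) \<le> \<alpha>0 * (E * \<alpha>0)"
    proof -
      have "0 < G" unfolding G_def using pq by simp
      moreover have "\<alpha> * G \<le> \<alpha>0 * G" using lym by linarith
      ultimately have "\<alpha> \<le> \<alpha>0" by simp
      then obtain e where e: "\<alpha>0 = \<alpha> + e" using le_Suc_ex by blast
      have "f * \<alpha>0 \<le> e * G" using lym f e by (simp add: algebra_simps)
      then have "D * (f * \<alpha>0) \<le> D * (e * G)" by (rule mult_le_mono2)
      also have "\<dots> = e * (D * G)" by simp
      also have "\<dots> \<le> e * (E * \<alpha>0)" using DG by (rule mult_le_mono2)
      finally have "\<alpha>0 * (D * f) \<le> \<alpha>0 * (E * e)" by (simp add: mult_ac)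
      then show ?thesis using e by (simp add: algebra_simps)
    qed
    then have lin: "D * f + E * \<alpha> \<le> E * \<alpha>0" using \<alpha>0 by simp
    have "a * b \<le> (D + \<alpha>) * (E + \<beta>)" unfolding b_eq \<alpha>_def by (intro mult_le_mono1) simp
    \<comment> \<open>Everything except \<open>\<alpha> * \<beta>\<close> is linear, so
      \<open>lin\<close> and \<open>prod\<close> bound the two parts separately.\<close>
    also have "\<dots> = D * E + D * \<beta>0 + (D * f + E * \<alpha>) + \<alpha> * \<beta>" unfolding f by (simp add: algebra_simps)
    also have "\<dots> \<le> D * E + D * \<beta>0 + E * \<alpha>0 + \<alpha>0 * \<beta>0" using lin prod by simp
    finally show ?thesis by (simp add: algebra_simps)
  qed
  then show "a * b \<le> extremal_A n k 1 2 * extremal_B n l 1 2" unfolding A2 B2 .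
qed

text \<open>Three nested inductions: on \<open>l\<close> for the exceptional pair
  \<open>(1, 2)\<close>, downwards on \<open>r\<close> from \<open>k\<close>, and upwards on
  \<open>s\<close>. The alternative \<open>s = 1\<close> admits the pair \<open>(0, 1)\<close> that
  the exceptional case calls for.\<close>

lemma product_bound_main:
  assumes "0 < k" "k \<le> l" "k + l \<le> n" "1 \<le> s" "s \<le> l" "1 \<le> r \<or> s = 1" "r \<le> k"
  shows "product_bound n k l r s"
  using assms
proof (induction l arbitrary: n k r s rule: less_induct)
  case outer: (less l)
  have descend: "product_bound n k l r s"
    if "r \<le> k" "1 \<le> s" "s \<le> l" "1 \<le> r \<or> s = 1" for r s
    using that
  proof (induction r arbitrary: s rule: inc_induct)
    case base
    then show ?case using outer.prems(1-3) by (intro product_bound_ge) auto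
  next
    case (step r)
    show ?case using step.prems
    proof (induction s rule: less_induct)
      case (less s')
      show ?case
      proof (cases "s' = 1")
        case True
        have "product_bound n k l (Suc r) l" using step.IH[of l] outer.prems(1,2) by simp
        then show ?thesis
          using True product_bound_star outer.prems(2,3) step.hyps by blast
      next
        case False
        then have s': "2 \<le> s'" "1 \<le> r" using less.prems by auto
        have prev: "product_bound n k l r (s' - 1)"
          using less.IH[of "s' - 1"] less.prems s' by simp
        show ?thesis
        proof (cases "(r, s') = (1, 2)")
          case True
          have "product_bound (n - 2) (k - 1) (l - 1) 0 1"
            using step.hyps True outer.prems(2,3) by (intro outer.IH) auto
          then show ?thesis
            using product_bound_1_2[of k l n] prev True step.hyps outer.prems(2,3) by auto
        next
          case ne: False
          then show ?thesis
            using product_bound_step prev s' less.prems step.hyps outer.prems(2,3) by blast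
        qed
      qed
    qed
  qed
  show ?case using descend outer.prems by blast
qed

theorem theorem3p1:
  fixes n k l r s :: nat
    and \<A> \<B> :: "nat set set"
  assumes "0 < k" and "k \<le> l" and "k + l \<le> n"
    and "\<A> \<subseteq> nsets {1..n} k" and "\<B> \<subseteq> nsets {1..n} l"
    and "cross_intersecting \<A> \<B>"
    and "1 \<le> r" and "2 \<le> s" and "s \<le> l"
    and "int (card \<B>) \<ge>
           (\<Sum>i=1..r. binom (int n - int i) (int l - 1)) + binom (int n - int r - int s) (int l - int s)"
  shows "int (card \<A>) * int (card \<B>) \<le>
           (binom (int n - int r) (int k - int r) - binom (int n - int r - int s) (int k - int r)) *
           ((\<Sum>i=1..r. binom (int n - int i) (int l - 1)) + binom (int n - int r - int s) (int l - int s))"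
proof -
  have cp: "cross_pair n k l (card \<A>) (card \<B>)"
    unfolding cross_pair_def using assms(4-6) by (intro exI[of _ "{1..n}"]) auto
  have binom: "binom (int x - int y) (int z - int w) = int (x - y choose (z - w))"
    if "y \<le> x" "w \<le> z" for x y z w
    using that unfolding binom_def by (simp add: nat_diff_distrib)
  have sum: "(\<Sum>i=1..j. binom (int n - int i) (int l - 1)) = int (\<Sum>i=1..j. n - i choose (l - 1))"
    if "j \<le> n" for j
    unfolding of_nat_sum using that assms(1,2) binom[of _ n 1 l] by (intro sum.cong) auto
  show ?thesis
  \<comment> \<open>For \<open>r \<le> k\<close> all differences are nonnegative and truncated
    subtraction agrees with \<open>binom\<close>. For \<open>r > k\<close> the right side vanishes,
    and the first \<open>k + 1\<close> summands already force \<open>\<A>\<close> to be empty;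
    \<open>r\<close> may even exceed \<open>n\<close> there.\<close>
  proof (cases "r \<le> k")
    case True
    have B: "(\<Sum>i=1..r. binom (int n - int i) (int l - 1)) +
        binom (int n - int r - int s) (int l - int s) = int (extremal_B n l r s)"
      unfolding extremal_B_def using sum[of r] binom[of "r + s" n s l] True assms
      by (simp add: diff_diff_eq)
    have "(n - r - s choose (k - r)) \<le> (n - r choose (k - r))"
      by (intro binomial_right_mono) simp
    then have A: "binom (int n - int r) (int k - int r) - binom (int n - int r - int s) (int k - int r) =
        int (extremal_A n k r s)"
      unfolding extremal_A_def using binom[of r n r k] binom[of "r + s" n r k] True assms
      by (simp add: diff_diff_eq of_nat_diff)
    have "product_bound n k l r s"
      using True assms by (intro product_bound_main) auto
    then have "card \<A> * card \<B> \<le> extremal_A n k r s * extremal_B n l r s"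
      using cp assms(10) unfolding product_bound_def B by simp
    then show ?thesis unfolding A B by (metis of_nat_le_iff of_nat_mult)
  next
    case False
    have nonneg: "0 \<le> binom x y" for x y by (simp add: binom_def)
    have "(\<Sum>i=1..Suc k. binom (int n - int i) (int l - 1)) \<le>
        (\<Sum>i=1..r. binom (int n - int i) (int l - 1))"
      using False nonneg by (intro sum_mono2) auto
    then have "int (\<Sum>i=1..Suc k. n - i choose (l - 1)) \<le> int (card \<B>)"
      using sum[of "Suc k"] assms(1-3,10) nonneg[of "int n - int r - int s" "int l - int s"] by linarith
    then have "(\<Sum>i=1..Suc k. n - i choose (l - 1)) \<le> card \<B>" by linarith
    then have "(\<Sum>i=1..k. n - i choose (l - 1)) + (n - Suc k choose (l - 1)) \<le> card \<B>" by simp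
    moreover have "0 < (n - Suc k choose (l - 1))" using assms by simp
    ultimately have "(\<Sum>i=1..k. n - i choose (l - 1)) < card \<B>" by linarith
    then have "card \<A> = 0" using cross_pair_empty[OF cp] assms by simp
    moreover have "binom x (int k - int r) = 0" for x using False by (simp add: binom_def)
    ultimately show ?thesis by simp
  qed
qed

end
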